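(* Let $K$ be a non-trivial field. Up to isomorphism, the 2-dimensional endo-commutative straight algebras of rank 1 over $K$ are classified into the four families $$S(0,0,0,0,0,0),\quad S(0,0,0,0,0,1),\quad \{S(0,0,0,1,0,\lambda)\}_{\lambda\in K},\quad S(0,1,0,1,0,1),$$ whose multiplication tables $\begin{pmatrix}e^2&ef\\ fe&f^2\end{pmatrix}$ on a linear base $\{e,f\}$ are $$\begin{pmatrix}f&0\\0&0\end{pmatrix},\quad \begin{pmatrix}f&0\\ f&0\end{pmatrix},\quad \begin{pmatrix}f&f\\ \lambda f&0\end{pmatrix},\quad \begin{pmatrix}f&f\\ f&f\end{pmatrix},$$ respectively. That is, each of these algebras is a 2-dimensional endo-commutative straight algebra of rank 1 over $K$; every 2-dimensional endo-commutative straight algebra of rank 1 over $K$ is isomorphic to one of them; and the listed algebras are pairwise non-isomorphic (in particular $S(0,0,0,1,0,\lambda)\not\cong S(0,0,0,1,0,\lambda')$ for $\lambda\neq\lambda'$ in $K$).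
   Context: A non-trivial field is a field other than $\mathbb F_2$, the field of two elements. An algebra over $K$ is a $K$-vector space with a bilinear multiplication, not assumed associative, commutative or unital; isomorphism means $K$-algebra isomorphism. An algebra $A$ is endo-commutative if $x^2y^2=(xy)^2$ for all $x,y\in A$. A 2-dimensional algebra $A$ is curled if $x^2$ is a scalar multiple of $x$ for every $x\in A$; otherwise it is straight (equivalently, there is $x\in A$ such that $x$ and $x^2$ are linearly independent). For a 2-dimensional algebra with linear base $\{e,f\}$, write $e^2=a_1e+b_1f$, $f^2=a_2e+b_2f$, $ef=a_3e+b_3f$, $fe=a_4e+b_4f$; the $4\times 2$ matrix over $K$ with rows $(a_1,b_1),(a_2,b_2),(a_3,b_3),(a_4,b_4)$ is the structure matrix of $A$ with respect to $\{e,f\}$. The rank of $A$ is the rank of its structure matrix with respect to a linear base (it does not depend on the base). For $p,q,a,b,c,d\in K$, $S(p,q,a,b,c,d)$ denotes the 2-dimensional algebra over $K$ with linear base $\{e,f\}$ and multiplication $e^2=f$, $f^2=pe+qf$, $ef=ae+bf$, $fe=ce+df$. *)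

theory Defs
  imports "HOL-Analysis.Cartesian_Space"
begin

locale nonassoc_algebra = vector_space sc
  for sc :: "'k::field \<Rightarrow> 'a::ab_group_add \<Rightarrow> 'a" +
  fixes mult :: "'a \<Rightarrow> 'a \<Rightarrow> 'a"
  assumes linear_mult_left: "Vector_Spaces.linear sc sc (\<lambda>x. mult x y)"
    and linear_mult_right: "Vector_Spaces.linear sc sc (\<lambda>y. mult x y)"

locale algebra_dim2 = nonassoc_algebra sc mult
  for sc :: "'k::field \<Rightarrow> 'a::ab_group_add \<Rightarrow> 'a" and mult +
  assumes dim_UNIV_eq_2: "dim UNIV = 2"

definition algebra_iso ::
    "('k::field \<Rightarrow> 'a::ab_group_add \<Rightarrow> 'a) \<Rightarrow> ('a \<Rightarrow> 'a \<Rightarrow> 'a) \<Rightarrow>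
     ('k \<Rightarrow> 'b::ab_group_add \<Rightarrow> 'b) \<Rightarrow> ('b \<Rightarrow> 'b \<Rightarrow> 'b) \<Rightarrow> ('a \<Rightarrow> 'b) \<Rightarrow> bool"
  where "algebra_iso s\<^sub>1 m\<^sub>1 s\<^sub>2 m\<^sub>2 \<phi> \<longleftrightarrow>
    Vector_Spaces.linear s\<^sub>1 s\<^sub>2 \<phi> \<and> bij \<phi> \<and> (\<forall>x y. \<phi> (m\<^sub>1 x y) = m\<^sub>2 (\<phi> x) (\<phi> y))"

definition isomorphic_algebras ::
    "('k::field \<Rightarrow> 'a::ab_group_add \<Rightarrow> 'a) \<Rightarrow> ('a \<Rightarrow> 'a \<Rightarrow> 'a) \<Rightarrow>
     ('k \<Rightarrow> 'b::ab_group_add \<Rightarrow> 'b) \<Rightarrow> ('b \<Rightarrow> 'b \<Rightarrow> 'b) \<Rightarrow> bool"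
  where "isomorphic_algebras s\<^sub>1 m\<^sub>1 s\<^sub>2 m\<^sub>2 \<longleftrightarrow> (\<exists>\<phi>. algebra_iso s\<^sub>1 m\<^sub>1 s\<^sub>2 m\<^sub>2 \<phi>)"

definition endo_commutative :: "('a \<Rightarrow> 'a \<Rightarrow> 'a) \<Rightarrow> bool"
  where "endo_commutative mult \<longleftrightarrow>
    (\<forall>x y. mult (mult x x) (mult y y) = mult (mult x y) (mult x y))"

definition curled :: "('k \<Rightarrow> 'a \<Rightarrow> 'a) \<Rightarrow> ('a \<Rightarrow> 'a \<Rightarrow> 'a) \<Rightarrow> bool"
  where "curled sc mult \<longleftrightarrow> (\<forall>x. \<exists>c. mult x x = sc c x)"

abbreviation straight :: "('k \<Rightarrow> 'a \<Rightarrow> 'a) \<Rightarrow> ('a \<Rightarrow> 'a \<Rightarrow> 'a) \<Rightarrow> bool"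
  where "straight sc mult \<equiv> \<not> curled sc mult"

context vector_space
begin

definition is_base2 :: "'b \<Rightarrow> 'b \<Rightarrow> bool"
  where "is_base2 e f \<longleftrightarrow> e \<noteq> f \<and> independent {e, f} \<and> span {e, f} = UNIV"

definition coords2 :: "'b \<Rightarrow> 'b \<Rightarrow> 'b \<Rightarrow> 'a^2"
  where "coords2 e f v = vector [representation {e, f} v e, representation {e, f} v f]"

end

context nonassoc_algebra
begin

definition structure_matrix :: "'a \<Rightarrow> 'a \<Rightarrow> 'k^2^4"
  where "structure_matrix e f =
    vector [coords2 e f (mult e e), coords2 e f (mult f f),
            coords2 e f (mult e f), coords2 e f (mult f e)]"

text \<open>The choice of base is immaterial, see \<open>algebra_rank_eq\<close> below.\<close>

definition algebra_rank :: nat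
  where "algebra_rank =
    (let (e, f) = (SOME (e, f). is_base2 e f) in rank (structure_matrix e f))"

end

lemma vector_4_nth:
  "(vector [w, x, y, z] :: 'c::zero^4) $ 1 = w"
  "(vector [w, x, y, z] :: 'c::zero^4) $ 2 = x"
  "(vector [w, x, y, z] :: 'c::zero^4) $ 3 = y"
  "(vector [w, x, y, z] :: 'c::zero^4) $ 4 = z"
  by (simp_all add: vector_def)

context algebra_dim2
begin

lemma ex_is_base2: "\<exists>e f. is_base2 e f"
proof -
  obtain B where B: "independent B" "span B = UNIV" "card B = 2"
    using dim_UNIV_eq_2 by (metis basis_exists dim_eq_card span_UNIV span_eq top.extremum_uniqueI)
  then obtain e f where "B = {e, f}" "e \<noteq> f"
    by (auto simp: card_2_iff)
  with B show ?thesis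
    unfolding is_base2_def by blast
qed

lemma rank_structure_matrix:
  assumes base: "is_base2 e f"
  shows "rank (structure_matrix e f) = dim (range (case_prod mult))"
proof -
  have ef: "e \<noteq> f" "independent {e, f}" "span {e, f} = UNIV"
    using base by (auto simp: is_base2_def)
  interpret fin: finite_dimensional_vector_space sc "{e, f}"
    by unfold_locales (use ef in auto)
  interpret pair: finite_dimensional_vector_space_pair_1 sc "{e, f}" "(*s) :: 'k \<Rightarrow> 'k^2 \<Rightarrow> 'k^2"
    by unfold_locales
  let ?P = "{mult e e, mult f f, mult e f, mult f e}"
  have lin: "Vector_Spaces.linear sc (*s) (coords2 e f)"
    by unfold_locales
      (simp_all add: coords2_def vec_eq_iff forall_2 representation_add representation_scale ef)
  have expand: "v = sc (representation {e, f} v e) e + sc (representation {e, f} v f) f" for v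
    using sum_representation_eq[of "{e, f}" v "{e, f}"] ef by simp
  have inj: "inj (coords2 e f)"
  proof (rule injI)
    fix u v assume "coords2 e f u = coords2 e f v"
    then have "representation {e, f} u e = representation {e, f} v e"
      "representation {e, f} u f = representation {e, f} v f"
      by (simp_all add: coords2_def vec_eq_iff forall_2)
    then show "u = v" using expand[of u] expand[of v] by simp
  qed
  have rows: "rows (structure_matrix e f) = coords2 e f ` ?P"
    unfolding rows_def row_def structure_matrix_def vec_lambda_eta Setcompr_eq_image UNIV_4
    by (simp add: vector_4_nth insert_commute)
  have "rank (structure_matrix e f) = dim ?P"
    unfolding row_rank_def_gen rows
    using pair.dim_image_eq[OF lin] inj by (meson inj_on_subset subset_UNIV)
  also have "span ?P = span (range (case_prod mult))"
  proof (rule span_eq[THEN iffD2], intro conjI)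
    show "?P \<subseteq> span (range (case_prod mult))"
    proof -
      have "mult x y \<in> range (case_prod mult)" for x y
        using rangeI[of "case_prod mult" "(x, y)"] by simp
      then show ?thesis by (auto intro: span_base)
    qed
    show "range (case_prod mult) \<subseteq> span ?P"
    proof clarsimp
      fix x y
      have l: "mult (sc a e + sc b f) y = sc a (mult e y) + sc b (mult f y)" for a b y
        using linear_mult_left[of y]
        by (simp add: module_hom_iff_linear[symmetric] module_hom_iff)
      have r: "mult x (sc a e + sc b f) = sc a (mult x e) + sc b (mult x f)" for a b x
        using linear_mult_right[of x]
        by (simp add: module_hom_iff_linear[symmetric] module_hom_iff)
      have "mult e y \<in> span ?P" "mult f y \<in> span ?P"
        by (subst expand[of y], unfold r, intro span_add span_scale span_base; simp)+
      then show "mult x y \<in> span ?P"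
        by (subst expand[of x], unfold l) (intro span_add span_scale)
    qed
  qed
  then have "dim ?P = dim (range (case_prod mult))"
    by (metis dim_span)
  finally show ?thesis .
qed

lemma algebra_rank_eq:
  assumes "is_base2 e f"
  shows "algebra_rank = rank (structure_matrix e f)"
proof -
  obtain e' f' where p: "(SOME (e, f). is_base2 e f) = (e', f')"
    by fastforce
  have "case (SOME (e, f). is_base2 e f) of (e, f) \<Rightarrow> is_base2 e f"
    by (rule someI[of _ "(e, f)"]) (use assms in simp)
  then have "is_base2 e' f'" by (simp add: p)
  then show ?thesis
    using assms by (simp add: algebra_rank_def p rank_structure_matrix)
qed

end

definition ec_straight_rank1 ::
    "('k::field \<Rightarrow> 'a::ab_group_add \<Rightarrow> 'a) \<Rightarrow> ('a \<Rightarrow> 'a \<Rightarrow> 'a) \<Rightarrow> bool"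
  where "ec_straight_rank1 sc mult \<longleftrightarrow>
    algebra_dim2 sc mult \<and> endo_commutative mult \<and> straight sc mult \<and>
    nonassoc_algebra.algebra_rank sc mult = 1"

abbreviation base_e :: "'k::field^2" where "base_e \<equiv> axis 1 1"
abbreviation base_f :: "'k::field^2" where "base_f \<equiv> axis 2 1"

text \<open>The multiplication of $S(p,q,a,b,c,d)$, with underlying space $K^2$.\<close>

definition Salg :: "'k::field \<Rightarrow> 'k \<Rightarrow> 'k \<Rightarrow> 'k \<Rightarrow> 'k \<Rightarrow> 'k \<Rightarrow> 'k^2 \<Rightarrow> 'k^2 \<Rightarrow> 'k^2"
  where "Salg p q a b c d x y =
    (x$1 * y$1) *s base_f + (x$2 * y$2) *s (p *s base_e + q *s base_f) +
    (x$1 * y$2) *s (a *s base_e + b *s base_f) + (x$2 * y$1) *s (c *s base_e + d *s base_f)"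

abbreviation isomorphic_S :: "('k::field^2 \<Rightarrow> 'k^2 \<Rightarrow> 'k^2) \<Rightarrow> ('k^2 \<Rightarrow> 'k^2 \<Rightarrow> 'k^2) \<Rightarrow> bool"
    (infix \<open>\<cong>\<^sub>S\<close> 50)
  where "m\<^sub>1 \<cong>\<^sub>S m\<^sub>2 \<equiv> isomorphic_algebras (*s) m\<^sub>1 (*s) m\<^sub>2"

definition mult_table :: "('k::field^2 \<Rightarrow> 'k^2 \<Rightarrow> 'k^2) \<Rightarrow> ('k^2)^2^2"
  where "mult_table m = vector [vector [m base_e base_e, m base_e base_f],
                                vector [m base_f base_e, m base_f base_f]]"

lemma Salg_base:
  "Salg p q a b c d base_e base_e = base_f"
  "Salg p q a b c d base_f base_f = p *s base_e + q *s base_f"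
  "Salg p q a b c d base_e base_f = a *s base_e + b *s base_f"
  "Salg p q a b c d base_f base_e = c *s base_e + d *s base_f"
  by (simp_all add: Salg_def axis_def vec_eq_iff)

lemma is_base2_base: "vec.is_base2 (base_e :: 'k::field^2) base_f"
proof -
  have "cart_basis = {base_e, base_f :: 'k^2}"
    unfolding cart_basis_def Setcompr_eq_image UNIV_2 by simp
  moreover have "base_e \<noteq> (base_f :: 'k^2)"
    by (simp add: axis_eq_axis)
  ultimately show ?thesis
    using vec.independent_Basis vec.span_Basis unfolding vec.is_base2_def by metis
qed

lemma algebra_dim2_Salg: "algebra_dim2 (*s) (Salg p q a b c d)"
proof unfold_locales
  show "vec.dim (UNIV :: ('a^2) set) = 2"
    by (simp only: vec.dim_UNIV card_cart_basis) simp
qed (simp_all add: Salg_def vec_eq_iff forall_2 algebra_simps axis_def)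

end

theory Submission
  imports Defs
begin

text \<open>
  Rank 1 says that all products lie on one line. In a straight algebra pick \<open>e\<close> with
  \<open>e\<close> and \<open>f = e\<^sup>2\<close> independent; since \<open>f\<close> is a non-zero product, that line is spanned by \<open>f\<close>,
  so the multiplication is \<open>x y = B(x,y) f\<close> for a bilinear form \<open>B\<close> with \<open>B(e,e) = 1\<close>. It is
  described by the three scalars \<open>q = B(f,f)\<close>, \<open>b = B(e,f)\<close>, \<open>d = B(f,e)\<close>, i.e. the algebra is
  \<open>S(0,q,0,b,0,d)\<close> (\<open>exists_rank1_base\<close>).

  Endo-commutativity becomes \<open>q B(x,x) B(y,y) = q B(x,y)\<^sup>2\<close>. So either \<open>q = 0\<close>, without any
  condition on \<open>b\<close> and \<open>d\<close>, or two choices of \<open>(x, y)\<close> force \<open>d = b\<close> and \<open>q = b\<^sup>2\<close>, and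
  then \<open>B\<close> is the square of the linear form with coordinates \<open>(1, b)\<close>
  (\<open>endo_commutative_rank1_base\<close>, \<open>ec_straight_rank1_Salg\<close>).

  Replacing \<open>e\<close> by \<open>t e\<close>, hence \<open>f\<close> by \<open>t\<^sup>2 f\<close>, turns \<open>(q, b, d)\<close> into
  \<open>(t\<^sup>2 q, t b, t d)\<close> (\<open>rescale_rank1_base\<close>). A suitable \<open>t\<close> normalises the first non-zero one of
  \<open>b\<close> and \<open>d\<close> to \<open>1\<close>, which leaves exactly the four families. Conversely, an isomorphism must
  preserve the vanishing of \<open>q\<close>, and when \<open>q = 0\<close> it changes \<open>(b, d)\<close> only by a common non-zero
  factor (\<open>isomorphic_Salg_rank1D\<close>). The families are thus told apart by whether \<open>q\<close> vanishes and,
  if it does, by whether \<open>(b, d)\<close> is zero and otherwise by the point \<open>(b : d)\<close> of the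
  projective line.
\<close>

section \<open>Algebras whose products are multiples of one base vector\<close>

lemma Salg_rank1_eq:
  "Salg 0 q 0 b 0 d x y =
     (x$1 * y$1 + q * (x$2 * y$2) + b * (x$1 * y$2) + d * (x$2 * y$1)) *s base_f"
  by (simp add: Salg_def vec_eq_iff forall_2 axis_def algebra_simps)

text \<open>
  When \<open>q = b\<^sup>2\<close> and \<open>d = b\<close>, the form is \<open>B(x,y) = (x\<^sub>1 + b x\<^sub>2) (y\<^sub>1 + b y\<^sub>2)\<close>, which makes
  \<open>B(x,x) B(y,y) = B(x,y)\<^sup>2\<close> an identity; when \<open>q = 0\<close>, products of products vanish.
\<close>

lemma ec_straight_rank1_Salg:
  fixes q b d :: "'k::field"
  assumes "q = 0 \<or> (q = b * b \<and> d = b)"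
  shows "ec_straight_rank1 (*s) (Salg 0 q 0 b 0 d)"
proof -
  let ?m = "Salg 0 q 0 b 0 d :: 'k^2 \<Rightarrow> 'k^2 \<Rightarrow> 'k^2"
  interpret A: algebra_dim2 "(*s)" ?m
    by (rule algebra_dim2_Salg)
  have "endo_commutative ?m"
    using assms
    by (auto simp: endo_commutative_def Salg_rank1_eq vec_eq_iff forall_2 axis_def algebra_simps)
  moreover have "straight (*s) ?m"
  proof
    assume "curled (*s) ?m"
    then obtain c where "?m base_e base_e = c *s base_e"
      unfolding curled_def by blast
    then have "base_f = c *s base_e"
      by (simp only: Salg_base)
    then show False
      by (simp add: vec_eq_iff forall_2 axis_def)
  qed
  moreover have "A.algebra_rank = 1"
  proof -
    have nz: "base_f \<noteq> (0 :: 'k^2)"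
      by (simp add: axis_eq_0_iff)
    have "?m base_e base_e \<in> range (case_prod ?m)"
      by (rule range_eqI[of _ _ "(base_e, base_e)"]) simp
    then have "{base_f} \<subseteq> range (case_prod ?m)"
      by (simp add: Salg_base)
    moreover have "range (case_prod ?m) \<subseteq> vec.span {base_f}"
    proof clarsimp
      fix x y
      show "?m x y \<in> vec.span {base_f}"
        unfolding Salg_rank1_eq by (intro vec.span_scale vec.span_base) simp
    qed
    ultimately have "vec.dim (range (case_prod ?m)) = 1"
      using vec.dim_unique[of "{base_f}" "range (case_prod ?m)" 1] nz by simp
    then show ?thesis
      using A.algebra_rank_eq[OF is_base2_base] A.rank_structure_matrix[OF is_base2_base] by simp
  qed
  ultimately show ?thesis
    unfolding ec_straight_rank1_def using A.algebra_dim2_axioms by blast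
qed

section \<open>Bases of the form \<open>e, e\<^sup>2\<close>\<close>

context nonassoc_algebra
begin

lemma mult_add_left: "mult (x + y) z = mult x z + mult y z"
  and mult_scale_left: "mult (sc c x) z = sc c (mult x z)"
  using linear_mult_left[of z] by (simp_all add: module_hom_iff_linear[symmetric] module_hom_iff)

lemma mult_add_right: "mult z (x + y) = mult z x + mult z y"
  and mult_scale_right: "mult z (sc c x) = sc c (mult z x)"
  using linear_mult_right[of z] by (simp_all add: module_hom_iff_linear[symmetric] module_hom_iff)

lemmas mult_linear = mult_add_left mult_scale_left mult_add_right mult_scale_right

definition rank1_base :: "'a \<Rightarrow> 'a \<Rightarrow> 'k \<Rightarrow> 'k \<Rightarrow> 'k \<Rightarrow> bool"
  where "rank1_base e f q b d \<longleftrightarrow> is_base2 e f \<and>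
    mult e e = f \<and> mult f f = sc q f \<and> mult e f = sc b f \<and> mult f e = sc d f"

lemma rank1_base_iso_Salg:
  assumes "rank1_base e f q b d"
  shows "isomorphic_algebras sc mult (*s) (Salg 0 q 0 b 0 d)"
proof -
  have ef: "e \<noteq> f" "independent {e, f}" "span {e, f} = UNIV"
    and mults: "mult e e = f" "mult f f = sc q f" "mult e f = sc b f" "mult f e = sc d f"
    using assms by (auto simp: rank1_base_def is_base2_def)
  \<comment> \<open>The isomorphism is the coordinate map. Products expand by bilinearity along its inverse
    \<open>\<psi>\<close>, so multiplicativity is proved for \<open>\<psi>\<close> and transferred.\<close>
  define \<psi> where "\<psi> v = sc (v$1) e + sc (v$2) f" for v :: "'k^2"
  let ?c = "coords2 e f"
  have lin: "Vector_Spaces.linear sc (*s) ?c"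
    by unfold_locales
      (simp_all add: coords2_def vec_eq_iff forall_2 representation_add representation_scale ef)
  have \<psi>c: "\<psi> (?c v) = v" for v
    using sum_representation_eq[of "{e, f}" v "{e, f}"] ef by (simp add: \<psi>_def coords2_def)
  have base: "?c e = base_e" "?c f = base_f"
    using ef by (simp_all add: coords2_def vec_eq_iff forall_2 axis_def representation_basis)
  have c\<psi>: "?c (\<psi> w) = w" for w
  proof -
    have "?c (\<psi> w) = w$1 *s base_e + w$2 *s base_f"
      using lin by (simp add: \<psi>_def base module_hom_iff_linear[symmetric] module_hom_iff)
    then show ?thesis
      by (simp add: vec_eq_iff forall_2 axis_def)
  qed
  have hom: "?c (mult x y) = Salg 0 q 0 b 0 d (?c x) (?c y)" for x y
  proof -
    have "mult (\<psi> v) (\<psi> w) = \<psi> (Salg 0 q 0 b 0 d v w)" for v w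
      by (simp add: \<psi>_def mult_linear mults Salg_rank1_eq axis_def algebra_simps
          scale_left_distrib)
    from this[of "?c x" "?c y"] show ?thesis
      by (simp add: \<psi>c c\<psi>)
  qed
  have "bij ?c"
    using \<psi>c c\<psi> by (intro bijI') metis+
  with lin hom show ?thesis
    unfolding isomorphic_algebras_def algebra_iso_def by blast
qed

lemma rescale_rank1_base:
  assumes "rank1_base e f q b d" and t: "t \<noteq> 0"
  shows "rank1_base (sc t e) (sc (t * t) f) (t * t * q) (t * b) (t * d)"
proof -
  have ef: "e \<noteq> f" "independent {e, f}" "span {e, f} = UNIV"
    and mults: "mult e e = f" "mult f f = sc q f" "mult e f = sc b f" "mult f e = sc d f"
    using assms by (auto simp: rank1_base_def is_base2_def)
  let ?E = "sc t e" and ?F = "sc (t * t) f"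
  have tt: "t * t \<noteq> 0"
    using t by simp
  have e_notin: "e \<notin> span {f}" and f0: "f \<noteq> 0"
    using ef by (auto simp: independent_insert)
  have line: "span {?F} = span {f}"
    by (rule span_image_scale[of "{f}" "\<lambda>_. t * t", simplified]) (use t in simp)
  have E_notin: "?E \<notin> span {?F}"
    using e_notin t span_scale[of ?E "{f}" "1 / t"] unfolding line by auto
  then have neq: "?E \<noteq> ?F"
    by (auto intro: span_base)
  have indep: "independent {?E, ?F}"
    using E_notin f0 tt by (simp add: independent_insert)
  have "sc (1 / t) ?E \<in> span {?E, ?F}" "sc (1 / (t * t)) ?F \<in> span {?E, ?F}"
    by (intro span_scale span_base; simp)+
  then have "{e, f} \<subseteq> span {?E, ?F}"
    using t by simp
  then have "span {?E, ?F} = UNIV"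
    using ef(3) span_minimal[of "{e, f}" "span {?E, ?F}"] by auto
  with neq indep show ?thesis
    by (simp add: rank1_base_def is_base2_def mult_linear mults mult_ac)
qed

text \<open>
  The pairs \<open>(e, f)\<close> and \<open>(e, e + f)\<close> give, after comparing the coefficients of \<open>f\<close>,
  \<open>q\<^sup>2 = q b\<^sup>2\<close> and \<open>q (1 + b + d + q) = q (1 + b)\<^sup>2\<close>.
\<close>

lemma endo_commutative_rank1_base:
  assumes base: "rank1_base e f q b d" and ec: "endo_commutative mult"
  shows "q = 0 \<or> (q = b * b \<and> d = b)"
proof (cases "q = 0")
  case False
  have mults: "mult e e = f" "mult f f = sc q f" "mult e f = sc b f" "mult f e = sc d f"
    and f0: "f \<noteq> 0"
    using base dependent_zero[of "{e, f}"] by (auto simp: rank1_base_def is_base2_def)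
  have ec': "mult (mult x x) (mult y y) = mult (mult x y) (mult x y)" for x y
    using ec unfolding endo_commutative_def by blast
  have "sc (q * q) f = sc (b * b * q) f"
    using ec'[of e f] by (simp add: mults mult_linear mult_ac)
  then have q: "q = b * b"
    using f0 False by simp
  have sq: "mult (e + f) (e + f) = sc (1 + b + d + q) f" and ef: "mult e (e + f) = sc (1 + b) f"
    by (simp_all add: mult_linear mults scale_left_distrib add_ac)
  have "sc (q * (1 + b + d + q)) f = sc (q * ((1 + b) * (1 + b))) f"
    using ec'[of e "e + f"] unfolding sq ef mults(1) mult_scale_left mult_scale_right mults(2)
    by (simp only: scale_scale mult_ac)
  then have "1 + b + d + q = (1 + b) * (1 + b)"
    using f0 False by simp
  with q show ?thesis
    by (simp add: algebra_simps)
qed simp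

end

text \<open>
  Straightness supplies \<open>e\<close> with \<open>e, e\<^sup>2\<close> independent. In a product space of dimension 1, the
  non-zero product \<open>e\<^sup>2\<close> already spans every other product.
\<close>

lemma (in algebra_dim2) exists_rank1_base:
  assumes straight: "straight sc mult" and rank: "algebra_rank = 1"
  obtains e q b d where "rank1_base e (mult e e) q b d"
proof -
  obtain e where e: "\<And>c. mult e e \<noteq> sc c e"
    using straight unfolding curled_def by blast
  define f where "f = mult e e"
  have e0: "e \<noteq> 0"
    using e[of 0] mult_scale_left[of 0 0 e] by auto
  have f_notin: "f \<notin> span {e}"
    using e by (auto simp: f_def span_singleton)
  then have neq: "e \<noteq> f" and f0: "f \<noteq> 0"
    by (auto intro: span_base span_zero)
  have indep: "independent {e, f}"
    using f_notin e0 neq by (subst insert_commute) (simp add: independent_insert)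
  obtain B where B: "finite B" "independent B" "span B = UNIV"
    using ex_is_base2 unfolding is_base2_def by (metis finite.intros)
  interpret fin: finite_dimensional_vector_space sc B
    by unfold_locales (use B in auto)
  have span: "span {e, f} = UNIV"
    using fin.card_ge_dim_independent[OF _ indep, of UNIV] neq dim_UNIV_eq_2 by auto
  have base: "is_base2 e f"
    using neq indep span by (simp add: is_base2_def)
  have "dim (range (case_prod mult)) = 1"
    using rank algebra_rank_eq[OF base] rank_structure_matrix[OF base] by simp
  moreover have "f \<in> range (case_prod mult)"
    by (rule range_eqI[of _ _ "(e, e)"]) (simp add: f_def)
  ultimately have "range (case_prod mult) \<subseteq> span {f}"
    using fin.card_ge_dim_independent[of "{f}" "range (case_prod mult)"] f0 by simp
  then have "mult x y \<in> span {f}" for x y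
    using range_eqI[of "mult x y" "case_prod mult" "(x, y)"] by auto
  then have "\<exists>c. mult x y = sc c f" for x y
    by (auto simp: span_singleton)
  then obtain q b d where "mult f f = sc q f" "mult e f = sc b f" "mult f e = sc d f"
    by metis
  with base have "rank1_base e (mult e e) q b d"
    by (simp add: rank1_base_def f_def)
  then show ?thesis
    by (rule that)
qed

section \<open>Normal forms\<close>

text \<open>
  In the case \<open>q = b\<^sup>2\<close>, \<open>d = b\<close> with \<open>q \<noteq> 0\<close>, the same factor \<open>1 / b\<close> that normalises \<open>b\<close>
  normalises \<open>d\<close> and \<open>q\<close> as well, so this case contributes a single algebra.
\<close>

lemma ec_straight_rank1_cases:
  assumes A: "ec_straight_rank1 sc mult"
  shows "isomorphic_algebras sc mult (*s) (Salg 0 0 0 0 0 0)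
    \<or> isomorphic_algebras sc mult (*s) (Salg 0 0 0 0 0 1)
    \<or> (\<exists>l. isomorphic_algebras sc mult (*s) (Salg 0 0 0 1 0 l))
    \<or> isomorphic_algebras sc mult (*s) (Salg 0 1 0 1 0 1)"
proof -
  interpret algebra_dim2 sc mult
    using A by (simp add: ec_straight_rank1_def)
  obtain e q b d where base: "rank1_base e (mult e e) q b d"
    using A exists_rank1_base unfolding ec_straight_rank1_def by blast
  have iso: "isomorphic_algebras sc mult (*s) (Salg 0 (t * t * q) 0 (t * b) 0 (t * d))"
    if "t \<noteq> 0" for t
    using rank1_base_iso_Salg[OF rescale_rank1_base[OF base that]] .
  have "q = 0 \<or> (q = b * b \<and> d = b)"
    using endo_commutative_rank1_base[OF base] A by (simp add: ec_straight_rank1_def)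
  then consider "q = 0" "b = 0" "d = 0" | "q = 0" "b = 0" "d \<noteq> 0" | "q = 0" "b \<noteq> 0"
    | "b \<noteq> 0" "q = b * b" "d = b"
    by fastforce
  then show ?thesis
  proof cases
    case 1
    then show ?thesis using iso[of 1] by simp
  next
    case 2
    then show ?thesis using iso[of "1 / d"] by simp
  next
    case 3
    then have "isomorphic_algebras sc mult (*s) (Salg 0 0 0 1 0 (d / b))"
      using iso[of "1 / b"] by simp
    then show ?thesis by blast
  next
    case 4
    then show ?thesis using iso[of "1 / b"] by simp
  qed
qed

section \<open>Invariants\<close>

text \<open>
  Let \<open>\<alpha>\<close>, \<open>\<beta>\<close> be the coordinates of the image of \<open>e\<close>. The image of \<open>f = e\<^sup>2\<close> is a product, hence
  \<open>\<kappa> f\<close> for some \<open>\<kappa>\<close>; comparing the images of \<open>f\<^sup>2\<close>, \<open>e f\<close>, \<open>f e\<close> with the products of the images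
  gives \<open>q = \<kappa> q'\<close>, \<open>b = \<alpha> b' + \<beta> q'\<close>, \<open>d = \<alpha> d' + \<beta> q'\<close>. Bijectivity makes \<open>\<kappa>\<close> and \<open>\<alpha>\<close> non-zero.
\<close>

lemma isomorphic_Salg_rank1D:
  fixes q b d q' b' d' :: "'k::field"
  assumes "Salg 0 q 0 b 0 d \<cong>\<^sub>S Salg 0 q' 0 b' 0 d'"
  shows "q = 0 \<longleftrightarrow> q' = 0"
    and "q = 0 \<Longrightarrow> \<exists>\<alpha>. \<alpha> \<noteq> 0 \<and> b = \<alpha> * b' \<and> d = \<alpha> * d'"
proof -
  let ?m = "Salg 0 q 0 b 0 d" and ?m' = "Salg 0 q' 0 b' 0 d'"
  obtain \<phi> where lin: "Vector_Spaces.linear (*s) (*s) \<phi>" and bij: "bij \<phi>"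
    and hom: "\<And>x y. \<phi> (?m x y) = ?m' (\<phi> x) (\<phi> y)"
    using assms unfolding isomorphic_algebras_def algebra_iso_def by blast
  have add: "\<phi> (x + y) = \<phi> x + \<phi> y" and scale: "\<phi> (c *s x) = c *s \<phi> x" for c x y
    using lin by (simp_all add: module_hom_iff_linear[symmetric] module_hom_iff)
  define \<alpha> \<beta> where "\<alpha> = \<phi> base_e $ 1" and "\<beta> = \<phi> base_e $ 2"
  define \<kappa> where "\<kappa> = \<phi> base_f $ 2"
  have f1: "\<phi> base_f $ 1 = 0"
    using hom[of base_e base_e] by (simp add: Salg_base Salg_rank1_eq axis_def)
  have \<kappa>0: "\<kappa> \<noteq> 0"
  proof
    assume "\<kappa> = 0"
    then have "\<phi> base_f = 0 *s \<phi> base_f"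
      using f1 by (simp add: \<kappa>_def vec_eq_iff forall_2)
    then have "\<phi> base_f = \<phi> (0 *s base_f)"
      by (simp only: scale)
    then have "base_f = (0 *s base_f :: 'k^2)"
      using bij by (simp only: bij_is_inj[THEN inj_eq])
    then show False
      by (simp add: axis_eq_0_iff)
  qed
  \<comment> \<open>If \<open>\<alpha>\<close> vanished, every value of \<open>\<phi>\<close> would be a multiple of \<open>f\<close>.\<close>
  have \<alpha>0: "\<alpha> \<noteq> 0"
  proof
    assume "\<alpha> = 0"
    obtain x where x: "\<phi> x = base_e"
      using bij by (metis bij_pointE)
    have "x = x$1 *s base_e + x$2 *s base_f"
      by (simp add: vec_eq_iff forall_2 axis_def)
    then have "\<phi> x $ 1 = x$1 * \<alpha> + x$2 * \<phi> base_f $ 1"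
      by (metis \<alpha>_def add scale vector_add_component vector_smult_component)
    then show False
      using x f1 \<open>\<alpha> = 0\<close> by (simp add: axis_def)
  qed
  have "q * \<kappa> = \<kappa> * q' * \<kappa>"
    using arg_cong[OF hom[of base_f base_f], of "\<lambda>v. v $ 2"] f1
    by (simp add: Salg_base scale Salg_rank1_eq \<kappa>_def axis_def mult_ac)
  then have q: "q = \<kappa> * q'"
    using \<kappa>0 by simp
  then show "q = 0 \<longleftrightarrow> q' = 0"
    using \<kappa>0 by simp
  assume "q = 0"
  then have q'0: "q' = 0"
    using q \<kappa>0 by simp
  have "b * \<kappa> = \<alpha> * b' * \<kappa>"
    using arg_cong[OF hom[of base_e base_f], of "\<lambda>v. v $ 2"] f1 q'0
    by (simp add: Salg_base scale Salg_rank1_eq \<kappa>_def \<alpha>_def axis_def mult_ac)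
  moreover have "d * \<kappa> = \<alpha> * d' * \<kappa>"
    using arg_cong[OF hom[of base_f base_e], of "\<lambda>v. v $ 2"] f1 q'0
    by (simp add: Salg_base scale Salg_rank1_eq \<kappa>_def \<alpha>_def axis_def mult_ac)
  ultimately show "\<exists>\<alpha>. \<alpha> \<noteq> 0 \<and> b = \<alpha> * b' \<and> d = \<alpha> * d'"
    using \<kappa>0 \<alpha>0 by auto
qed

section \<open>The classification\<close>

theorem theorem1:
  assumes nontrivial: "CARD('k::field) \<noteq> 2"
  shows
    "ec_straight_rank1 (*s) (Salg 0 0 0 0 0 (0::'k))
     \<and> ec_straight_rank1 (*s) (Salg 0 0 0 0 0 (1::'k))
     \<and> (\<forall>l::'k. ec_straight_rank1 (*s) (Salg 0 0 0 1 0 l))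
     \<and> ec_straight_rank1 (*s) (Salg 0 1 0 1 0 (1::'k))
     \<and> mult_table (Salg 0 0 0 0 0 (0::'k)) = vector [vector [base_f, 0], vector [0, 0]]
     \<and> mult_table (Salg 0 0 0 0 0 (1::'k)) = vector [vector [base_f, 0], vector [base_f, 0]]
     \<and> (\<forall>l::'k. mult_table (Salg 0 0 0 1 0 l) = vector [vector [base_f, base_f], vector [l *s base_f, 0]])
     \<and> mult_table (Salg 0 1 0 1 0 (1::'k)) = vector [vector [base_f, base_f], vector [base_f, base_f]]
     \<and> (\<forall>(sc :: 'k \<Rightarrow> 'a::ab_group_add \<Rightarrow> 'a) mult.
          ec_straight_rank1 sc mult \<longrightarrow>
            isomorphic_algebras sc mult (*s) (Salg 0 0 0 0 0 0)
            \<or> isomorphic_algebras sc mult (*s) (Salg 0 0 0 0 0 1)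
            \<or> (\<exists>l. isomorphic_algebras sc mult (*s) (Salg 0 0 0 1 0 l))
            \<or> isomorphic_algebras sc mult (*s) (Salg 0 1 0 1 0 1))
     \<and> \<not> Salg 0 0 0 0 0 (0::'k) \<cong>\<^sub>S Salg 0 0 0 0 0 1
     \<and> (\<forall>l::'k. \<not> Salg 0 0 0 0 0 0 \<cong>\<^sub>S Salg 0 0 0 1 0 l)
     \<and> \<not> Salg 0 0 0 0 0 (0::'k) \<cong>\<^sub>S Salg 0 1 0 1 0 1
     \<and> (\<forall>l::'k. \<not> Salg 0 0 0 0 0 1 \<cong>\<^sub>S Salg 0 0 0 1 0 l)
     \<and> \<not> Salg 0 0 0 0 0 (1::'k) \<cong>\<^sub>S Salg 0 1 0 1 0 1
     \<and> (\<forall>l::'k. \<not> Salg 0 0 0 1 0 l \<cong>\<^sub>S Salg 0 1 0 1 0 1)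
     \<and> (\<forall>l l'::'k. l \<noteq> l' \<longrightarrow> \<not> Salg 0 0 0 1 0 l \<cong>\<^sub>S Salg 0 0 0 1 0 l')"
proof (intro conjI allI impI)
  fix sc :: "'k \<Rightarrow> 'a \<Rightarrow> 'a" and mult
  assume "ec_straight_rank1 sc mult"
  then show "isomorphic_algebras sc mult (*s) (Salg 0 0 0 0 0 0)
      \<or> isomorphic_algebras sc mult (*s) (Salg 0 0 0 0 0 1)
      \<or> (\<exists>l. isomorphic_algebras sc mult (*s) (Salg 0 0 0 1 0 l))
      \<or> isomorphic_algebras sc mult (*s) (Salg 0 1 0 1 0 1)"
    by (rule ec_straight_rank1_cases)
next
  fix l l' :: 'k
  assume "l \<noteq> l'"
  then show "\<not> Salg 0 0 0 1 0 l \<cong>\<^sub>S Salg 0 0 0 1 0 l'"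
    using isomorphic_Salg_rank1D(2)[of 0 1 l 0 1 l'] by auto
next
  fix l :: 'k
  show "\<not> Salg 0 0 0 0 0 0 \<cong>\<^sub>S Salg 0 0 0 1 0 l"
    using isomorphic_Salg_rank1D(2)[of 0 0 0 0 1 l] by auto
  show "\<not> Salg 0 0 0 0 0 1 \<cong>\<^sub>S Salg 0 0 0 1 0 l"
    using isomorphic_Salg_rank1D(2)[of 0 0 1 0 1 l] by auto
  show "\<not> Salg 0 0 0 1 0 l \<cong>\<^sub>S Salg 0 1 0 1 0 1"
    using isomorphic_Salg_rank1D(1)[of 0 1 l 1 1 1] by auto
next
  show "\<not> Salg 0 0 0 0 0 0 \<cong>\<^sub>S Salg 0 0 0 0 0 (1::'k)"
    using isomorphic_Salg_rank1D(2)[of 0 0 0 0 0 "1::'k"] by auto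
  show "\<not> Salg 0 0 0 0 0 0 \<cong>\<^sub>S Salg 0 1 0 1 0 (1::'k)"
    using isomorphic_Salg_rank1D(1)[of 0 0 0 "1::'k" 1 1] by auto
  show "\<not> Salg 0 0 0 0 0 1 \<cong>\<^sub>S Salg 0 1 0 1 0 (1::'k)"
    using isomorphic_Salg_rank1D(1)[of 0 0 1 "1::'k" 1 1] by auto
qed (simp_all add: mult_table_def Salg_base ec_straight_rank1_Salg)

end
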